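(* Let $\mathcal{G}\subseteq\mathbb{R}^n$ be a sub-module of the $\mathbb{Z}$-module $\mathbb{R}^n$, $\mathcal{S}\subseteq\mathcal{G}$ a finite set with $M$ points, $X\subseteq\mathcal{S}$ the foreground and $\overline X=\mathcal{S}\setminus X$ the background. Let $\mathcal{C}$ be a restricted chamfer mask (with integer weights) and $d=d_{\mathcal{C}}$. Let $a\in\mathbb{Z}^n$ satisfy $\sum_ia_iv^i\neq0$ for every vector $\vec v$ of $\mathcal{C}$, with scanning masks $\mathcal{C}_1,\mathcal{C}_2$, and let $p_1,\dots,p_M$ be a scanning order of $\mathcal{S}$ supported by $\mathcal{C}_1$ such that the reversed order $p_M,\dots,p_1$ is supported by $\mathcal{C}_2$. Run the chamfer algorithm: initially $f(p)=+\infty$ for $p\in X$ and $f(p)=0$ for $p\in\overline X$; then scan the points in the order $p_1,\dots,p_M$ using $l=1$, and afterwards in the order $p_M,\dots,p_1$ using $l=2$, where visiting $p_i$ in scan $l$ performs $$f(p_i)\leftarrow\min\Big(\min_{(\vec v_j,w_j)\in\mathcal{C}_l,\ p_i+\vec v_j\in\mathcal{S}}\big(w_j+f(p_i+\vec v_j)\big),\ f(p_i)\Big).$$ If either (i) every border point of $\mathcal{S}$ belongs to $\overline X$, or (ii) $\mathcal{S}$ is wedge-preserving, then after the two scans $f(p)=d(p,\overline X)=\inf_{q\in\overline X}d(p,q)$ for every $p\in\mathcal{S}$.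
   Context: A sub-module of the $\mathbb{Z}$-module $\mathbb{R}^n$ is an additive subgroup of $\mathbb{R}^n$; coordinates are in the canonical basis. A basis of $\mathcal{G}$ is a family of $n$ vectors, linearly independent over $\mathbb{Z}$, generating $\mathcal{G}$ over $\mathbb{Z}$. For a finite $\mathcal{C}=\{(\vec v_k,w_k)\}\subseteq\mathcal{G}\times\mathbb{Z}$, a path from $x$ to $y$ is given by integers $\alpha_k\ge0$ with $\sum_k\alpha_k\vec v_k=y-x$, of cost $\sum_k\alpha_kw_k$, and $d_{\mathcal{C}}(x,y)$ is the minimum cost (paths in $\mathcal{G}$). The $\mathcal{G}$-sector $\langle\langle\vec u_1,\dots,\vec u_n\rangle\rangle$ of independent vectors is the set of points of $\mathcal{G}$ equal to $\sum_k\lambda_k\vec u_k$ with real $\lambda_k\ge0$; a wedge of $\mathcal{C}$ is such a sector generated by $n$ vectors of $\mathcal{C}$ and containing no other vector of $\mathcal{C}$. A restricted chamfer mask is a finite $\mathcal{C}\subseteq\mathcal{G}\times\mathbb{Z}$ with: $w_k>0$, $\vec v_k\ne0$; symmetry $(\vec v,w)\in\mathcal{C}\Rightarrow(-\vec v,w)\in\mathcal{C}$; its vectors are arranged into a collection of wedges whose generators each form a basis of $\mathcal{G}$, with every $p\in\mathcal{G}$ equal to $\sum_{k=1}^n\alpha_k\vec v_{i_k}$, integers $\alpha_k\ge0$, for the generators of some wedge; and the polytope whose faces are the $(n-1)$-simplices with vertices $\frac{1}{w_{i_1}}\vec v_{i_1},\dots,\frac{1}{w_{i_n}}\vec v_{i_n}$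 (one per wedge) is convex. Scanning masks: $\mathcal{C}_1=\{(\vec v,w)\in\mathcal{C}:\sum_ia_iv^i<0\}$, $\mathcal{C}_2=\{(\vec v,w)\in\mathcal{C}:\sum_ia_iv^i>0\}$. A scanning order is an enumeration $p_1,\dots,p_M$ of $\mathcal{S}$; a scanning mask $\mathcal{C}_l$ supports it if for every $i$ and every vector $\vec v$ of $\mathcal{C}_l$, either $p_i+\vec v\notin\mathcal{S}$ or $p_i+\vec v=p_{i'}$ for some $i'<i$. A border point is $x\in\mathcal{S}$ with $x+\vec v\notin\mathcal{S}$ for some vector $\vec v$ of $\mathcal{C}$. For $b\in\mathbb{Z}^n$, $\sigma\in\mathbb{R}$ and a relation $\square\in\{<,\le,=,\ge,>\}$, let $\mathcal{T}^b_{\sigma,\square}=\{x\in\mathcal{G}:\sum_ib_ix^i\,\square\,\sigma\}$. Given $b,\sigma$ such that some point of $\mathcal{S}$ lies in $\mathcal{T}^b_{\sigma,=}$, the half-spaces $\mathcal{T}^b_{\sigma,\le}$ and $\mathcal{T}^b_{\sigma,\ge}$ are wedge-preserving if for every $x\in\mathcal{T}^b_{\sigma,=}$ and every wedge $W$ of $\mathcal{C}$, either $x+\vec v\in\mathcal{T}^b_{\sigma,\le}$ for all generating vectors $\vec v$ of $W$, or $x+\vec v\in\mathcal{T}^b_{\sigma,\ge}$ for all generating vectors $\vec v$ of $W$. $\mathcal{S}$ is wedge-preserving if it is the intersection of wedge-preserving half-spaces. *)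

theory Defs
  imports "HOL-Analysis.Analysis"
begin

definition zscale :: "int \<Rightarrow> 'a::real_vector \<Rightarrow> 'a" where
  "zscale k x = of_int k *\<^sub>R x"

global_interpretation zmod: module "zscale :: int \<Rightarrow> 'a::real_vector \<Rightarrow> 'a"
  by standard (simp_all add: zscale_def scaleR_add_right scaleR_add_left)

definition zbasis :: "(real^'n) set \<Rightarrow> (real^'n) set \<Rightarrow> bool" where
  "zbasis G U \<longleftrightarrow> card U = CARD('n) \<and> zmod.independent U \<and> zmod.span U = G"

definition int_form :: "int^'n \<Rightarrow> real^'n \<Rightarrow> real" where
  "int_form b x = (\<Sum>i\<in>UNIV. of_int (b $ i) * x $ i)"


text \<open>A path is the family of its multiplicities, indexed by the elements of the mask.\<close>

definition mask_paths ::
    "((real^'n) \<times> int) set \<Rightarrow> real^'n \<Rightarrow> real^'n \<Rightarrow> ((real^'n) \<times> int \<Rightarrow> nat) set" where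
  "mask_paths C x y = {\<alpha>. (\<Sum>c\<in>C. real (\<alpha> c) *\<^sub>R fst c) = y - x}"

definition path_cost :: "((real^'n) \<times> int) set \<Rightarrow> ((real^'n) \<times> int \<Rightarrow> nat) \<Rightarrow> int" where
  "path_cost C \<alpha> = (\<Sum>c\<in>C. int (\<alpha> c) * snd c)"

text \<open>For positive weights the costs are nonnegative integers, so that the infimum is a
  minimum as soon as a path exists; it is \<open>\<infinity>\<close> if there is none.\<close>

definition chamfer_dist :: "((real^'n) \<times> int) set \<Rightarrow> real^'n \<Rightarrow> real^'n \<Rightarrow> ereal" where
  "chamfer_dist C x y = (INF \<alpha>\<in>mask_paths C x y. ereal (of_int (path_cost C \<alpha>)))"


definition sector :: "(real^'n) set \<Rightarrow> (real^'n) set \<Rightarrow> (real^'n) set" where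
  "sector G U = {x \<in> G. \<exists>l. (\<forall>u\<in>U. 0 \<le> l u) \<and> x = (\<Sum>u\<in>U. l u *\<^sub>R u)}"

text \<open>A wedge is represented by its set \<open>U\<close> of generators; these are exactly the vectors of the
  mask lying in the sector, so the sector determines \<open>U\<close>.\<close>

definition wedge :: "(real^'n) set \<Rightarrow> ((real^'n) \<times> int) set \<Rightarrow> (real^'n) set \<Rightarrow> bool" where
  "wedge G C U \<longleftrightarrow>
     U \<subseteq> fst ` C \<and> card U = CARD('n) \<and> independent U \<and> sector G U \<inter> fst ` C = U"

definition wedge_simplex :: "((real^'n) \<times> int) set \<Rightarrow> (real^'n) set \<Rightarrow> (real^'n) set" where
  "wedge_simplex C U = convex hull {(1 / of_int w) *\<^sub>R v | v w. (v, w) \<in> C \<and> v \<in> U}"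

text \<open>In the last condition \<open>polytope\<close> is the library notion, which includes convexity: the
  simplices form the boundary of a convex polytope. Several of them may lie in a common
  hyperplane, so they need not be facets in the sense of \<open>facet_of\<close>. The condition also
  forces every vector of the mask to carry a single weight.\<close>

definition restricted_chamfer_mask ::
    "(real^'n) set \<Rightarrow> ((real^'n) \<times> int) set \<Rightarrow> bool" where
  "restricted_chamfer_mask G C \<longleftrightarrow>
     finite C \<and> C \<subseteq> G \<times> UNIV \<and>
     (\<forall>(v, w)\<in>C. w > 0 \<and> v \<noteq> 0) \<and>
     (\<forall>(v, w)\<in>C. (- v, w) \<in> C) \<and>
     (\<exists>\<W>. (\<forall>U\<in>\<W>. wedge G C U \<and> zbasis G U) \<and>
          \<Union>\<W> = fst ` C \<and>
          (\<forall>p\<in>G. \<exists>U\<in>\<W>. \<exists>\<alpha> :: real^'n \<Rightarrow> nat. p = (\<Sum>u\<in>U. real (\<alpha> u) *\<^sub>R u)) \<and>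
          (\<exists>P. polytope P \<and> frontier P = (\<Union>U\<in>\<W>. wedge_simplex C U)))"


definition scanning_mask1 ::
    "int^'n \<Rightarrow> ((real^'n) \<times> int) set \<Rightarrow> ((real^'n) \<times> int) set" where
  "scanning_mask1 a C = {(v, w) \<in> C. int_form a v < 0}"

definition scanning_mask2 ::
    "int^'n \<Rightarrow> ((real^'n) \<times> int) set \<Rightarrow> ((real^'n) \<times> int) set" where
  "scanning_mask2 a C = {(v, w) \<in> C. int_form a v > 0}"

definition scanning_order :: "(real^'n) set \<Rightarrow> (real^'n) list \<Rightarrow> bool" where
  "scanning_order S ps \<longleftrightarrow> distinct ps \<and> set ps = S"

definition supports ::
    "(real^'n) set \<Rightarrow> ((real^'n) \<times> int) set \<Rightarrow> (real^'n) list \<Rightarrow> bool" where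
  "supports S D ps \<longleftrightarrow>
     (\<forall>i<length ps. \<forall>v\<in>fst ` D. ps ! i + v \<notin> S \<or> (\<exists>i'<i. ps ! i + v = ps ! i'))"

definition border_point ::
    "(real^'n) set \<Rightarrow> ((real^'n) \<times> int) set \<Rightarrow> real^'n \<Rightarrow> bool" where
  "border_point S C x \<longleftrightarrow> x \<in> S \<and> (\<exists>v\<in>fst ` C. x + v \<notin> S)"


definition rel_space ::
    "(real^'n) set \<Rightarrow> int^'n \<Rightarrow> real \<Rightarrow> (real \<Rightarrow> real \<Rightarrow> bool) \<Rightarrow> (real^'n) set" where
  "rel_space G b \<sigma> R = {x \<in> G. R (int_form b x) \<sigma>}"

definition wedge_preserving_halfspaces ::
    "(real^'n) set \<Rightarrow> ((real^'n) \<times> int) set \<Rightarrow> (real^'n) set \<Rightarrow> int^'n \<Rightarrow> real \<Rightarrow> bool" where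
  "wedge_preserving_halfspaces G C S b \<sigma> \<longleftrightarrow>
     S \<inter> rel_space G b \<sigma> (=) \<noteq> {} \<and>
     (\<forall>x\<in>rel_space G b \<sigma> (=). \<forall>U. wedge G C U \<longrightarrow>
        (\<forall>v\<in>U. x + v \<in> rel_space G b \<sigma> (\<le>)) \<or> (\<forall>v\<in>U. x + v \<in> rel_space G b \<sigma> (\<ge>)))"

definition wedge_preserving ::
    "(real^'n) set \<Rightarrow> ((real^'n) \<times> int) set \<Rightarrow> (real^'n) set \<Rightarrow> bool" where
  "wedge_preserving G C S \<longleftrightarrow>
     (\<exists>\<H>. (\<forall>H\<in>\<H>. \<exists>b \<sigma>. wedge_preserving_halfspaces G C S b \<sigma> \<and>
                 (H = rel_space G b \<sigma> (\<le>) \<or> H = rel_space G b \<sigma> (\<ge>))) \<and>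
          S = G \<inter> \<Inter>\<H>)"


text \<open>Images are total functions; their values outside \<open>S\<close> are never read. The infimum over
  an empty set of neighbours is \<open>\<infinity>\<close>.\<close>

definition visit ::
    "(real^'n) set \<Rightarrow> ((real^'n) \<times> int) set \<Rightarrow> real^'n \<Rightarrow> (real^'n \<Rightarrow> ereal) \<Rightarrow> (real^'n \<Rightarrow> ereal)"
  where
  "visit S D p f =
     f(p := min (INF (v, w)\<in>{(v, w) \<in> D. p + v \<in> S}. ereal (of_int w) + f (p + v)) (f p))"

definition scan ::
    "(real^'n) set \<Rightarrow> ((real^'n) \<times> int) set \<Rightarrow> (real^'n) list \<Rightarrow> (real^'n \<Rightarrow> ereal) \<Rightarrow> (real^'n \<Rightarrow> ereal)"
  where
  "scan S D ps f = fold (visit S D) ps f"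

definition initial_image :: "(real^'n) set \<Rightarrow> real^'n \<Rightarrow> ereal" where
  "initial_image X p = (if p \<in> X then \<infinity> else 0)"

definition chamfer_algorithm ::
    "(real^'n) set \<Rightarrow> (real^'n) set \<Rightarrow> ((real^'n) \<times> int) set \<Rightarrow> ((real^'n) \<times> int) set \<Rightarrow>
     (real^'n) list \<Rightarrow> (real^'n \<Rightarrow> ereal)" where
  "chamfer_algorithm S X C1 C2 ps = scan S C2 (rev ps) (scan S C1 ps (initial_image X))"

end

theory Submission
  imports Defs
begin

text \<open>
  The recorded values are always costs of paths to the background, so they are at least the
  distance. Conversely, a path may be reordered so that its steps in the second scanning mask come
  first; if it stays inside \<open>S\<close>, the two scans see all of it. When border points are background,
  a path that leaves \<open>S\<close> has already met the background. When \<open>S\<close> is wedge-preserving, a path whose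
  steps all lie in one wedge stays inside \<open>S\<close>, because on a wedge every bounding form has constant
  sign; and such a path has minimal cost. Indeed the convex polytope \<open>P\<close> has the origin in its interior,
  the cost of any path to \<open>p\<close> is some \<open>A\<close> with \<open>p \<in> A P\<close>, whereas the wedge path has cost \<open>B\<close> with
  \<open>p\<close> on the frontier of \<open>B P\<close>, whence \<open>B \<le> A\<close>.
\<close>

section \<open>Minimality of wedge paths\<close>

text \<open>The simplex spanned by 0 and suitable multiples of the \<open>u\<close> lies in both
  \<open>P\<close> and \<open>-P\<close>. A point \<open>a\<close> of its interior thus gives
  \<open>a\<close> and \<open>- a\<close> in the interior of \<open>P\<close>, and 0 is their
  midpoint.\<close>

lemma zero_in_interior_symmetric:
  fixes P U :: "'a::euclidean_space set"
  assumes P: "convex P" and U: "independent U" "card U = DIM('a)"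
    and r: "\<And>u. u \<in> U \<Longrightarrow> \<exists>r>0. r *\<^sub>R u \<in> P \<and> - (r *\<^sub>R u) \<in> P"
  shows "0 \<in> interior P"
proof -
  obtain r where r: "\<And>u. u \<in> U \<Longrightarrow> r u > 0 \<and> r u *\<^sub>R u \<in> P \<and> - (r u *\<^sub>R u) \<in> P"
    using r by metis
  define B where "B = (\<lambda>u. r u *\<^sub>R u) ` U"
  have fin: "finite U" using U(1) by (rule independent_imp_finite)
  have "U \<noteq> {}" using U(2) by auto
  then obtain u where u: "u \<in> U" by blast
  have "(1/2) *\<^sub>R (r u *\<^sub>R u) + (1/2) *\<^sub>R (- (r u *\<^sub>R u)) \<in> P"
    using r[OF u] by (intro convexD[OF P]) auto
  then have 0: "0 \<in> P" by simp
  have "v \<in> span B" if "v \<in> U" for v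
  proof -
    have "(1 / r v) *\<^sub>R (r v *\<^sub>R v) \<in> span B"
      using that by (intro span_scale span_base) (auto simp: B_def)
    then show ?thesis using r[OF that] by simp
  qed
  then have "span U \<subseteq> span B" by (simp add: span_minimal subsetI)
  moreover have "span U = UNIV"
    using U dim_eq_full[of U] dim_eq_card_independent[of U] by simp
  ultimately have sp: "UNIV \<subseteq> span B" by simp
  \<comment> \<open>A spanning set with at most \<open>DIM('a)\<close> elements is independent, so
    injectivity of the rescaling needs no separate argument.\<close>
  have finB: "finite B" and cB: "card B \<le> DIM('a)"
    using fin U(2) card_image_le[of U] by (auto simp: B_def)
  have indB: "independent B"
    by (rule card_le_dim_spanning[OF subset_UNIV sp finB]) (use cB in simp)
  have cardB: "card B = DIM('a)"
    using basis_card_eq_dim[OF subset_UNIV sp indB] by simp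
  obtain a where a: "a \<in> interior (convex hull (insert 0 B))"
    using interior_simplex_nonempty[OF indB finB cardB] by blast
  have "convex hull (insert 0 B) \<subseteq> P"
    by (rule hull_minimal) (use 0 r P in \<open>auto simp: B_def\<close>)
  then have aP: "a \<in> interior P" using a interior_mono by blast
  have "convex hull (insert 0 B) \<subseteq> uminus ` P"
  proof (rule hull_minimal)
    show "insert 0 B \<subseteq> uminus ` P"
      using 0 r by (auto simp: B_def image_iff) (metis minus_minus)+
    show "convex (uminus ` P)" using P by (rule convex_negations)
  qed
  then have "a \<in> interior (uminus ` P)" using a interior_mono by blast
  then have "- a \<in> interior P" by (auto simp: interior_negations)
  then have "(1/2) *\<^sub>R a + (1/2) *\<^sub>R (- a) \<in> interior P"
    using aP by (intro convexD[OF convex_interior[OF P]]) auto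
  then show ?thesis by simp
qed

text \<open>This is the Minkowski gauge of \<open>P\<close> in disguise: with
  \<open>A = sum s C\<close> the combination lies in \<open>A P\<close>. If \<open>A < B\<close>,
  division by \<open>B\<close> would shrink a point of \<open>P\<close> strictly towards the
  interior point 0 and so land in the interior.\<close>

lemma frontier_gauge_le:
  fixes P :: "'a::euclidean_space set" and x :: "'i \<Rightarrow> 'a"
  assumes P: "convex P" "0 \<in> interior P"
    and C: "finite C" "\<And>c. c \<in> C \<Longrightarrow> x c \<in> P" "\<And>c. c \<in> C \<Longrightarrow> 0 \<le> s c"
    and q: "(1 / B) *\<^sub>R (\<Sum>c\<in>C. s c *\<^sub>R x c) \<in> frontier P" and "0 < B"
  shows "B \<le> (\<Sum>c\<in>C. s c)"
proof (rule ccontr)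
  assume "\<not> ?thesis"
  then have AB: "sum s C < B" by simp
  let ?A = "sum s C" and ?p = "\<Sum>c\<in>C. s c *\<^sub>R x c"
  have A0: "0 \<le> ?A" using C(3) by (rule sum_nonneg)
  have "(1 / B) *\<^sub>R ?p \<in> interior P"
  \<comment> \<open>Normalising the coefficients needs a nonzero total; when it vanishes, the point
    in question is 0 itself.\<close>
  proof (cases "?A = 0")
    case True
    then have "\<forall>c\<in>C. s c = 0" using sum_nonneg_eq_0_iff[of C s] C by simp
    then show ?thesis using P(2) by simp
  next
    case False
    then have A: "?A > 0" using A0 by simp
    have "(\<Sum>c\<in>C. (s c / ?A) *\<^sub>R x c) \<in> P"
      by (rule convex_sum[OF C(1) P(1)])
        (use C A in \<open>auto simp: sum_divide_distrib[symmetric]\<close>)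
    also have "(\<Sum>c\<in>C. (s c / ?A) *\<^sub>R x c) = (1 / ?A) *\<^sub>R ?p"
      by (simp add: scaleR_sum_right)
    \<comment> \<open>The factor \<open>1 - ?A / B\<close> lies strictly between 0 and 1 and is
      chosen so that the contraction towards 0 ends exactly at \<open>?p\<close> divided by
      \<open>B\<close>.\<close>
    finally have "(1 / ?A) *\<^sub>R ?p - (1 - ?A / B) *\<^sub>R ((1 / ?A) *\<^sub>R ?p - 0) \<in> interior P"
      using A AB \<open>0 < B\<close> by (intro mem_interior_convex_shrink[OF P]) auto
    also have "(1 / ?A) *\<^sub>R ?p - (1 - ?A / B) *\<^sub>R ((1 / ?A) *\<^sub>R ?p - 0) = (1 / B) *\<^sub>R ?p"
      using A by (simp add: scaleR_left_diff_distrib[symmetric] diff_divide_distrib)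
    finally show ?thesis .
  qed
  then show False using q by (simp add: frontier_def)
qed

text \<open>Dividing the end point by the cost of the wedge path puts it on the simplex of
  \<open>U\<close>, hence on the frontier of \<open>P\<close>; the gauge comparison then bounds that
  cost by the cost of any other path.\<close>

lemma wedge_path_minimal:
  fixes C :: "((real^'n) \<times> int) set"
  assumes C: "finite C" "\<And>v w. (v, w) \<in> C \<Longrightarrow> w > 0" "\<And>v w. (v, w) \<in> C \<Longrightarrow> (- v, w) \<in> C"
    and W: "\<And>U. U \<in> \<W> \<Longrightarrow> wedge G C U" "\<Union>\<W> = fst ` C"
    and P: "polytope P" "frontier P = (\<Union>U\<in>\<W>. wedge_simplex C U)"
    and U: "U \<in> \<W>" and wt: "\<And>u. u \<in> U \<Longrightarrow> (u, wt u) \<in> C" and \<beta>: "\<And>u. u \<in> U \<Longrightarrow> 0 \<le> \<beta> u"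
    and eq: "(\<Sum>c\<in>C. real (\<alpha> c) *\<^sub>R fst c) = (\<Sum>u\<in>U. \<beta> u *\<^sub>R u)"
  shows "(\<Sum>u\<in>U. \<beta> u * of_int (wt u)) \<le> real_of_int (path_cost C \<alpha>)"
proof -
  have cP: "convex P" and clP: "closed P"
    using P(1) by (auto simp: polytope_imp_convex polytope_imp_closed)
  \<comment> \<open>Each mask vector generates some wedge, so dividing it by its weight gives a
    point of a simplex on the frontier of the closed set \<open>P\<close>.\<close>
  have inP: "(1 / of_int w) *\<^sub>R v \<in> P" if "(v, w) \<in> C" for v w
  proof -
    have "v \<in> \<Union>\<W>" unfolding W(2) using that by force
    then obtain V where V: "V \<in> \<W>" "v \<in> V" by blast
    have "(1 / of_int w) *\<^sub>R v \<in> wedge_simplex C V"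
      unfolding wedge_simplex_def by (rule hull_inc) (use that V in blast)
    then have "(1 / of_int w) *\<^sub>R v \<in> frontier P" using P(2) V by blast
    then show ?thesis using clP frontier_subset_eq by blast
  qed
  have indU: "independent U" "card U = CARD('n)" using W(1)[OF U] by (auto simp: wedge_def)
  have finU: "finite U" using indU(1) by (rule independent_imp_finite)
  have 0: "0 \<in> interior P"
  proof (rule zero_in_interior_symmetric[OF cP indU(1)])
    show "\<exists>r>0. r *\<^sub>R u \<in> P \<and> - (r *\<^sub>R u) \<in> P" if "u \<in> U" for u
      using inP[OF wt[OF that]] inP[OF C(3)[OF wt[OF that]]] C(2)[OF wt[OF that]]
      by (intro exI[of _ "1 / of_int (wt u)"] conjI) simp_all
  qed (use indU in simp)
  \<comment> \<open>The weights move from the vectors to the coefficients: the points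
    \<open>x c\<close> lie in \<open>P\<close>, and the coefficients \<open>s c\<close> add up to
    the cost of \<open>\<alpha>\<close>.\<close>
  define B where "B = (\<Sum>u\<in>U. \<beta> u * of_int (wt u))"
  define s where "s c = real (\<alpha> c) * of_int (snd c)" for c :: "(real^'n) \<times> int"
  define x where "x c = (1 / of_int (snd c)) *\<^sub>R fst c" for c :: "(real^'n) \<times> int"
  have wpos: "wt u > 0" if "u \<in> U" for u using C(2) wt that by blast
  have B0: "0 \<le> B" unfolding B_def using \<beta> wpos by (intro sum_nonneg) (simp add: less_imp_le)
  have cost: "real_of_int (path_cost C \<alpha>) = sum s C" by (simp add: path_cost_def s_def)
  have s0: "0 \<le> s c" if "c \<in> C" for c
    using C(2)[of "fst c" "snd c"] that by (simp add: s_def)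
  show ?thesis
  proof (cases "B = 0")
    case True
    then show ?thesis using s0 by (simp add: cost B_def[symmetric] sum_nonneg)
  next
    case False
    then have B: "0 < B" using B0 by simp
    have "(\<Sum>c\<in>C. s c *\<^sub>R x c) = (\<Sum>c\<in>C. real (\<alpha> c) *\<^sub>R fst c)"
      by (rule sum.cong) (use C(2) in \<open>force simp: s_def x_def\<close>)+
    also have "(1 / B) *\<^sub>R \<dots> = (\<Sum>u\<in>U. (\<beta> u * of_int (wt u) / B) *\<^sub>R ((1 / of_int (wt u)) *\<^sub>R u))"
      unfolding eq scaleR_sum_right by (rule sum.cong) (use wpos in force)+
    \<comment> \<open>The shares of the single generators in the total cost \<open>B\<close> serve
      as convex coefficients.\<close>
    also have "\<dots> \<in> wedge_simplex C U"
    proof (rule convex_sum[OF finU])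
      show "convex (wedge_simplex C U)" by (simp add: wedge_simplex_def)
      show "(\<Sum>u\<in>U. \<beta> u * of_int (wt u) / B) = 1"
        using B by (simp add: sum_divide_distrib[symmetric] B_def[symmetric])
      show "0 \<le> \<beta> u * of_int (wt u) / B" if "u \<in> U" for u
        using \<beta>[OF that] wpos[OF that] B by simp
      show "(1 / of_int (wt u)) *\<^sub>R u \<in> wedge_simplex C U" if "u \<in> U" for u
        unfolding wedge_simplex_def by (rule hull_inc) (use wt[OF that] that in blast)
    qed
    finally have "(1 / B) *\<^sub>R (\<Sum>c\<in>C. s c *\<^sub>R x c) \<in> frontier P" using P(2) U by blast
    then have "B \<le> sum s C"
      using cP 0 C(1) inP s0 B by (intro frontier_gauge_le[where x = x]) (auto simp: x_def)
    then show ?thesis by (simp add: cost B_def)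
  qed
qed

section \<open>The two scans\<close>

lemma fold_visit_outside: "x \<notin> set ps \<Longrightarrow> fold (visit S D) ps f x = f x"
  by (induction ps arbitrary: f) (auto simp: visit_def)

lemma scan_le: "scan S D ps f x \<le> f x"
proof -
  have visit: "visit S D p g x \<le> g x" for p g by (simp add: visit_def)
  show ?thesis unfolding scan_def
    by (induction ps arbitrary: f) (auto intro: order_trans visit)
qed

text \<open>Support puts the only visit of \<open>p + v\<close> before the only visit of
  \<open>p\<close>. The visit of \<open>p\<close> therefore reads a value that is already final, and
  the value it writes is final too.\<close>

lemma scan_step_le:
  assumes "scanning_order S ps" "supports S D ps" "(v, w) \<in> D" "p \<in> S" "p + v \<in> S"
  shows "scan S D ps f p \<le> ereal (of_int w) + scan S D ps f (p + v)"
proof -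
  have dist: "distinct ps" and set: "set ps = S" using assms(1) by (auto simp: scanning_order_def)
  obtain i where i: "i < length ps" "ps ! i = p" using assms(4) set by (metis in_set_conv_nth)
  obtain j where j: "j < i" "p + v = ps ! j"
    using assms(2,3,5) i unfolding supports_def by force
  define xs ys where "xs = take i ps" and "ys = drop (Suc i) ps"
  have ps: "ps = xs @ p # ys" using i id_take_nth_drop[of i ps] by (simp add: xs_def ys_def)
  have "p + v \<in> set xs"
    using i j by (auto simp: xs_def in_set_conv_nth intro!: exI[of _ j])
  then have out: "p \<notin> set ys" "p + v \<notin> set ys" "p + v \<noteq> p" using dist by (auto simp: ps)
  define h where "h = fold (visit S D) xs f"
  have "scan S D ps f p = visit S D p h p"
    by (simp add: scan_def ps h_def fold_visit_outside out)
  also have "\<dots> \<le> (INF (v, w)\<in>{(v, w) \<in> D. p + v \<in> S}. ereal (of_int w) + h (p + v))"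
    by (simp add: visit_def)
  also have "\<dots> \<le> ereal (of_int w) + h (p + v)"
    using assms(3,5) by (intro INF_lower2[of "(v, w)"]) auto
  also have "h (p + v) = scan S D ps f (p + v)"
    using out by (simp add: scan_def ps h_def fold_visit_outside visit_def)
  finally show ?thesis .
qed

text \<open>Being bounded below by \<open>L\<close> is invariant under each visit, since every
  candidate in the minimum respects the bound. It will be used with \<open>L\<close> the distance to
  the background.\<close>

lemma scan_lower_bound:
  assumes L: "\<And>p v w. (v, w) \<in> D \<Longrightarrow> p \<in> S \<Longrightarrow> p + v \<in> S \<Longrightarrow> L p \<le> ereal (of_int w) + L (p + v)"
    and f: "\<And>p. p \<in> S \<Longrightarrow> L p \<le> f p" and "p \<in> S"
  shows "L p \<le> scan S D ps f p"
proof -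
  have visit: "L p \<le> visit S D x f p" if f: "\<And>p. p \<in> S \<Longrightarrow> L p \<le> f p" and "p \<in> S" for p x f
  proof (cases "p = x")
    case True
    have "L x \<le> ereal (of_int w) + f (x + v)" if "(v, w) \<in> D" "x + v \<in> S" for v w
      using L[OF that(1) _ that(2)] f[OF that(2)] \<open>p \<in> S\<close> True by (meson add_left_mono order_trans)
    then show ?thesis using f[OF \<open>p \<in> S\<close>] True by (auto simp: visit_def intro!: INF_greatest)
  qed (use that in \<open>simp add: visit_def\<close>)
  have "L p \<le> fold (visit S D) ps f p" if "p \<in> S"
    using f that
  proof (induction ps arbitrary: f)
    case (Cons x ps)
    show ?case using Cons.IH[of "visit S D x f"] visit[of f] Cons.prems by simp
  qed simp
  then show ?thesis using \<open>p \<in> S\<close> by (simp add: scan_def)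
qed

section \<open>Paths\<close>

text \<open>One more use of \<open>(v, w)\<close> turns a path from \<open>p + v\<close> into a path
  from \<open>p\<close>.\<close>

lemma chamfer_dist_step:
  assumes "finite C" "(v, w) \<in> C"
  shows "chamfer_dist C p q \<le> ereal (of_int w) + chamfer_dist C (p + v) q"
proof -
  \<comment> \<open>The finite weight is moved to the left, so that the possibly infinite infimum on
    the right can be treated path by path.\<close>
  have "chamfer_dist C p q - ereal (of_int w) \<le> chamfer_dist C (p + v) q"
    unfolding chamfer_dist_def[of C "p + v"]
  proof (rule INF_greatest)
    fix \<alpha> assume "\<alpha> \<in> mask_paths C (p + v) q"
    then have \<alpha>: "(\<Sum>c\<in>C. real (\<alpha> c) *\<^sub>R fst c) = q - (p + v)" by (simp add: mask_paths_def)
    define \<beta> where "\<beta> c = \<alpha> c + (if c = (v, w) then 1 else 0)" for c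
    have "(\<Sum>c\<in>C. real (\<beta> c) *\<^sub>R fst c)
        = (\<Sum>c\<in>C. real (\<alpha> c) *\<^sub>R fst c) + (\<Sum>c\<in>C. if c = (v, w) then fst c else 0)"
      unfolding sum.distrib[symmetric]
      by (rule sum.cong) (auto simp: \<beta>_def scaleR_add_left)
    also have "\<dots> = q - p" using assms by (simp add: \<alpha>)
    finally have "\<beta> \<in> mask_paths C p q" by (simp add: mask_paths_def)
    moreover have "path_cost C \<beta> = path_cost C \<alpha> + w"
    proof -
      have "path_cost C \<beta> = path_cost C \<alpha> + (\<Sum>c\<in>C. if c = (v, w) then snd c else 0)"
        unfolding path_cost_def sum.distrib[symmetric]
        by (rule sum.cong) (auto simp: \<beta>_def algebra_simps)
      then show ?thesis using assms by simp
    qed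
    ultimately have "chamfer_dist C p q \<le> ereal (of_int (path_cost C \<alpha> + w))"
      unfolding chamfer_dist_def by (intro INF_lower2[of \<beta>]) auto
    then show "chamfer_dist C p q - ereal (of_int w) \<le> ereal (of_int (path_cost C \<alpha>))"
      by (simp add: ereal_minus_le)
  qed
  then show ?thesis by (simp add: ereal_minus_le add.commute)
qed

lemma chamfer_dist_refl_le: "chamfer_dist C p p \<le> 0"
  unfolding chamfer_dist_def
  by (rule INF_lower2[of "\<lambda>_. 0"]) (auto simp: mask_paths_def path_cost_def)

section \<open>Paths as lists of steps\<close>

abbreviation steps_sum :: "('a::comm_monoid_add \<times> int) list \<Rightarrow> 'a" where
  "steps_sum cs \<equiv> sum_list (map fst cs)"

abbreviation steps_cost :: "('a \<times> int) list \<Rightarrow> int" where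
  "steps_cost cs \<equiv> sum_list (map snd cs)"

text \<open>Each \<open>e i\<close> is repeated \<open>n i\<close> times. The index map
  \<open>e\<close> covers both the whole mask and the generators of a wedge paired with chosen
  weights.\<close>

lemma multiplicities_as_steps:
  fixes e :: "'i \<Rightarrow> 'a::real_vector \<times> int"
  assumes "finite I"
  shows "\<exists>cs. set cs \<subseteq> e ` I \<and> steps_sum cs = (\<Sum>i\<in>I. real (n i) *\<^sub>R fst (e i)) \<and>
    steps_cost cs = (\<Sum>i\<in>I. int (n i) * snd (e i))"
  using assms
proof induction
  case (insert i I)
  then obtain cs where cs: "set cs \<subseteq> e ` I" "steps_sum cs = (\<Sum>i\<in>I. real (n i) *\<^sub>R fst (e i))"
    "steps_cost cs = (\<Sum>i\<in>I. int (n i) * snd (e i))" by blast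
  have "steps_sum (replicate k (e i)) = real k *\<^sub>R fst (e i) \<and>
      steps_cost (replicate k (e i)) = int k * snd (e i)" for k
    by (induction k) (auto simp: algebra_simps)
  then show ?case using cs insert.hyps
    by (intro exI[of _ "replicate (n i) (e i) @ cs"]) auto
qed simp

text \<open>Addition commutes, so a path can use its steps from the second scanning mask first
  without changing its end point.\<close>

lemma steps_sum_partition:
  "steps_sum (filter Q cs @ filter (\<lambda>c. \<not> Q c) cs) = steps_sum cs"
  by (induction cs) (auto simp: algebra_simps)

lemma steps_cost_partition:
  "steps_cost (filter Q cs @ filter (\<lambda>c. \<not> Q c) cs) = steps_cost cs"
  by (induction cs) auto

lemma steps_cost_nonneg:
  assumes "\<And>v w. (v, w) \<in> D \<Longrightarrow> 0 < w" "set cs \<subseteq> D"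
  shows "0 \<le> steps_cost cs"
  using assms(2) by (induction cs) (auto dest: assms(1))

lemma follow_steps:
  fixes g :: "real^'n \<Rightarrow> ereal"
  assumes g: "\<And>x v w. (v, w) \<in> D \<Longrightarrow> x \<in> S \<Longrightarrow> x + v \<in> S \<Longrightarrow> g x \<le> ereal (of_int w) + g (x + v)"
    and stop: "\<And>x. x \<in> B \<Longrightarrow> g x \<le> 0"
    and pos: "\<And>v w. (v, w) \<in> D \<Longrightarrow> 0 < w"
    and cs: "set cs \<subseteq> D" "p \<in> S"
    and stay: "\<And>xs v w ys. cs = xs @ (v, w) # ys \<Longrightarrow> p + steps_sum xs \<in> S \<Longrightarrow>
      p + steps_sum xs + v \<in> S \<or> p + steps_sum xs \<in> B"
    and fin: "p + steps_sum cs \<in> S \<Longrightarrow> g (p + steps_sum cs) \<le> ereal (of_int t)" and "0 \<le> t"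
  shows "g p \<le> ereal (of_int (steps_cost cs + t))"
  using cs stay fin
proof (induction cs arbitrary: p)
  case (Cons c cs)
  obtain v w where c: "c = (v, w)" by (cases c)
  have D: "(v, w) \<in> D" using Cons.prems(1) c by simp
  show ?case
  proof (cases "p + v \<in> S")
    case True
    have "g (p + v) \<le> ereal (of_int (steps_cost cs + t))"
    proof (rule Cons.IH)
      fix xs v' w' ys assume "cs = xs @ (v', w') # ys" "p + v + steps_sum xs \<in> S"
      then show "p + v + steps_sum xs + v' \<in> S \<or> p + v + steps_sum xs \<in> B"
        using Cons.prems(3)[of "c # xs" v' w' ys] by (simp add: c add.assoc)
    qed (use Cons.prems True in \<open>auto simp: c add.assoc\<close>)
    moreover have "g p \<le> ereal (of_int w) + g (p + v)" using g D Cons.prems(2) True by blast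
    ultimately have "g p \<le> ereal (of_int w) + ereal (of_int (steps_cost cs + t))"
      by (meson add_left_mono order_trans)
    then show ?thesis by (simp add: c add.assoc)
  next
    case False
    then have "g p \<le> 0" using Cons.prems(2) Cons.prems(3)[of "[]" v w cs] stop by (simp add: c)
    moreover have "0 \<le> steps_cost (c # cs)"
      using pos Cons.prems(1) by (rule steps_cost_nonneg)
    ultimately show ?thesis using \<open>0 \<le> t\<close> by (auto intro: order_trans)
  qed
qed simp

section \<open>Linear forms along wedge paths\<close>

lemma int_form_add: "int_form b (x + y) = int_form b x + int_form b y"
  by (simp add: int_form_def algebra_simps sum.distrib)

lemma int_form_steps_sum:
  "int_form b (steps_sum cs) = (\<Sum>c\<leftarrow>cs. int_form b (fst c))"
  by (induction cs) (auto simp: int_form_add, simp add: int_form_def)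

text \<open>A form of constant sign on \<open>U\<close> is monotone along a path with steps in
  \<open>U\<close>, so its intermediate values lie between those at the ends.\<close>

lemma int_form_step_sum_between:
  assumes sgn: "(\<forall>u\<in>U. int_form b u \<le> 0) \<or> (\<forall>u\<in>U. 0 \<le> int_form b u)"
    and "fst ` set (xs @ ys) \<subseteq> U"
  shows "min (int_form b p) (int_form b (p + steps_sum (xs @ ys))) \<le> int_form b (p + steps_sum xs)"
    and "int_form b (p + steps_sum xs) \<le> max (int_form b p) (int_form b (p + steps_sum (xs @ ys)))"
proof -
  define s where "s zs = (\<Sum>c\<leftarrow>zs. int_form b (fst c))" for zs :: "((real^'a) \<times> int) list"
  have eqs: "int_form b (p + steps_sum xs) = int_form b p + s xs"
    "int_form b (p + steps_sum (xs @ ys)) = int_form b p + s xs + s ys"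
    by (simp_all only: int_form_add int_form_steps_sum s_def map_append sum_list_append add.assoc)
  have "(s xs \<le> 0 \<and> s ys \<le> 0) \<or> (0 \<le> s xs \<and> 0 \<le> s ys)"
    using sgn
  proof
    assume "\<forall>u\<in>U. 0 \<le> int_form b u"
    then have "0 \<le> s xs \<and> 0 \<le> s ys"
      using assms(2) unfolding s_def by (intro conjI sum_list_nonneg) auto
    then show ?thesis ..
  next
    assume "\<forall>u\<in>U. int_form b u \<le> 0"
    then have "s xs \<le> 0 \<and> s ys \<le> 0"
      using assms(2) unfolding s_def by (intro conjI sum_list_nonpos) auto
    then show ?thesis ..
  qed
  then show "min (int_form b p) (int_form b (p + steps_sum (xs @ ys))) \<le> int_form b (p + steps_sum xs)"
    and "int_form b (p + steps_sum xs) \<le> max (int_form b p) (int_form b (p + steps_sum (xs @ ys)))"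
    unfolding eqs by auto
qed

text \<open>Each bounding form has constant sign on the generators, hence is monotone along the
  path; both ends satisfy the bound, and so does every point between them.\<close>

lemma wedge_preserving_stay:
  assumes wp: "wedge_preserving G C S" and G: "zmod.subspace G" and U: "wedge G C U" "U \<subseteq> G"
    and p: "p \<in> S" and q: "p + steps_sum (xs @ ys) \<in> S" and cs: "fst ` set (xs @ ys) \<subseteq> U"
  shows "p + steps_sum xs \<in> S"
proof -
  obtain \<H> where H: "\<And>H. H \<in> \<H> \<Longrightarrow> \<exists>b \<sigma>. wedge_preserving_halfspaces G C S b \<sigma> \<and>
      (H = rel_space G b \<sigma> (\<le>) \<or> H = rel_space G b \<sigma> (\<ge>))" and S: "S = G \<inter> \<Inter>\<H>"
    using wp unfolding wedge_preserving_def by metis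
  have "steps_sum zs \<in> G" if "fst ` set zs \<subseteq> G" for zs :: "((real^'a) \<times> int) list"
    using that by (induction zs) (auto intro: zmod.subspace_add[OF G] zmod.subspace_0[OF G])
  then have inG: "p + steps_sum xs \<in> G"
    using p S cs U(2) by (intro zmod.subspace_add[OF G]) auto
  have "p + steps_sum xs \<in> H" if HH: "H \<in> \<H>" for H
  proof -
    obtain b \<sigma> where wph: "wedge_preserving_halfspaces G C S b \<sigma>"
      and Hb: "H = rel_space G b \<sigma> (\<le>) \<or> H = rel_space G b \<sigma> (\<ge>)" using H[OF HH] by blast
    \<comment> \<open>\<open>S\<close> meets the bounding hyperplane. Subtracting the value at such
      a point turns wedge preservation into a sign condition on the generators alone.\<close>
    obtain x where x: "x \<in> rel_space G b \<sigma> (=)"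
      using wph unfolding wedge_preserving_halfspaces_def by blast
    then have "(\<forall>v\<in>U. x + v \<in> rel_space G b \<sigma> (\<le>)) \<or> (\<forall>v\<in>U. x + v \<in> rel_space G b \<sigma> (\<ge>))"
      using wph U(1) unfolding wedge_preserving_halfspaces_def by blast
    then have "(\<forall>u\<in>U. int_form b u \<le> 0) \<or> (\<forall>u\<in>U. 0 \<le> int_form b u)"
      using x by (auto simp: rel_space_def int_form_add)
    note between = int_form_step_sum_between[OF this cs, of p]
    have "p \<in> H" "p + steps_sum (xs @ ys) \<in> H" using p q S HH by blast+
    with Hb inG between show ?thesis
      by (auto simp: rel_space_def min_def max_def split: if_splits)
  qed
  then show ?thesis using S inG by blast
qed

section \<open>Equality of the scanned image with the distance\<close>

theorem theorem3p1:
  fixes G S X :: "(real^'n) set"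
    and C :: "((real^'n) \<times> int) set"
    and a :: "int^'n"
    and ps :: "(real^'n) list"
  assumes "zmod.subspace G"
    and "finite S" and "S \<subseteq> G" and "X \<subseteq> S"
    and "restricted_chamfer_mask G C"
    and "\<forall>v\<in>fst ` C. int_form a v \<noteq> 0"
    and "scanning_order S ps"
    and "supports S (scanning_mask1 a C) ps"
    and "supports S (scanning_mask2 a C) (rev ps)"
    and "(\<forall>x. border_point S C x \<longrightarrow> x \<in> S - X) \<or> wedge_preserving G C S"
  shows "\<forall>p\<in>S. chamfer_algorithm S X (scanning_mask1 a C) (scanning_mask2 a C) ps p
                = (INF q\<in>S - X. chamfer_dist C p q)"
proof
  fix p assume p: "p \<in> S"
  note mask = assms(5)[unfolded restricted_chamfer_mask_def]
  have fin: "finite C" and CG: "C \<subseteq> G \<times> UNIV" using mask by blast+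
  have pos: "0 < w" and sym: "(- v, w) \<in> C" if "(v, w) \<in> C" for v w using mask that by blast+
  obtain \<W> P where W: "\<forall>U\<in>\<W>. wedge G C U \<and> zbasis G U" and W2: "\<Union>\<W> = fst ` C"
    and gen: "\<forall>p\<in>G. \<exists>U\<in>\<W>. \<exists>\<alpha> :: real^'n \<Rightarrow> nat. p = (\<Sum>u\<in>U. real (\<alpha> u) *\<^sub>R u)"
    and P: "polytope P" "frontier P = (\<Union>U\<in>\<W>. wedge_simplex C U)"
    using mask by (elim conjE exE)
  have W1: "\<And>U. U \<in> \<W> \<Longrightarrow> wedge G C U" using W by blast
  define C1 C2 where "C1 = scanning_mask1 a C" and "C2 = scanning_mask2 a C"
  have C12: "C1 \<subseteq> C" "C2 \<subseteq> C" by (auto simp: C1_def C2_def scanning_mask1_def scanning_mask2_def)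
  define F1 where "F1 = scan S C1 ps (initial_image X)"
  define F2 where "F2 = scan S C2 (rev ps) F1"
  have rev_order: "scanning_order S (rev ps)" using assms(7) by (simp add: scanning_order_def)
  have step1: "F1 x \<le> ereal (of_int w) + F1 (x + v)" if "(v, w) \<in> C1" "x \<in> S" "x + v \<in> S" for x v w
    using scan_step_le[OF assms(7,8)] that by (simp add: F1_def C1_def)
  have step2: "F2 x \<le> ereal (of_int w) + F2 (x + v)" if "(v, w) \<in> C2" "x \<in> S" "x + v \<in> S" for x v w
    using scan_step_le[OF rev_order assms(9)] that by (simp add: F2_def C2_def)
  have F21: "F2 x \<le> F1 x" for x by (simp add: F2_def scan_le)
  have stop1: "F1 x \<le> 0" if "x \<in> S - X" for x
    using scan_le[of S C1 ps "initial_image X" x] that by (simp add: F1_def initial_image_def)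
  have stop2: "F2 x \<le> 0" if "x \<in> S - X" for x using F21 stop1[OF that] order_trans by blast

  \<comment> \<open>The condition \<open>stay\<close> is asked of every reordering of
    \<open>cs\<close>, because the steps are about to be sorted by scanning mask.\<close>
  have steps_bound: "F2 p \<le> ereal (of_int (steps_cost cs))"
    if cs: "set cs \<subseteq> C" and q: "p + steps_sum cs \<in> S - X"
      and stay: "\<And>xs v w ys. mset (xs @ (v, w) # ys) = mset cs \<Longrightarrow> p + steps_sum xs \<in> S \<Longrightarrow>
        p + steps_sum xs + v \<in> S \<or> p + steps_sum xs \<in> S - X" for cs
  proof -
    define Q where "Q c \<longleftrightarrow> int_form a (fst c) > 0" for c :: "(real^'n) \<times> int"
    define cs2 cs1 where "cs2 = filter Q cs" and "cs1 = filter (\<lambda>c. \<not> Q c) cs"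
    have sub2: "set cs2 \<subseteq> C2" using cs by (auto simp: cs2_def C2_def scanning_mask2_def Q_def)
    have sub1: "set cs1 \<subseteq> C1"
      \<comment> \<open>The form \<open>a\<close> vanishes on no mask vector, so a step that is not
        positive is negative.\<close>
      using cs assms(6) by (force simp: cs1_def C1_def scanning_mask1_def Q_def)
    have sum: "steps_sum cs2 + steps_sum cs1 = steps_sum cs"
      using steps_sum_partition[of Q cs] by (simp add: cs1_def cs2_def)
    have cost: "steps_cost cs2 + steps_cost cs1 = steps_cost cs"
      using steps_cost_partition[of Q cs] by (simp add: cs1_def cs2_def)
    have ms: "mset (cs2 @ cs1) = mset cs" by (simp add: cs1_def cs2_def)
    \<comment> \<open>The last scan is unrolled first: \<open>F2\<close> is followed along
      \<open>cs2\<close>, with the cost of \<open>cs1\<close> left over as \<open>t\<close>. At the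
      point reached, \<open>F2\<close> is at most \<open>F1\<close>, which is followed along
      \<open>cs1\<close> into the background.\<close>
    have "F2 p \<le> ereal (of_int (steps_cost cs2 + steps_cost cs1))"
    proof (rule follow_steps[where D = C2 and S = S and B = "S - X", OF step2 stop2 _ sub2 p])
      show "0 \<le> steps_cost cs1"
        using pos subset_trans[OF sub1 C12(1)] by (rule steps_cost_nonneg)
      show "p + steps_sum xs + v \<in> S \<or> p + steps_sum xs \<in> S - X"
        if "cs2 = xs @ (v, w) # ys" "p + steps_sum xs \<in> S" for xs v w ys
        using stay[of xs v w "ys @ cs1"] that ms by simp
      show "F2 (p + steps_sum cs2) \<le> ereal (of_int (steps_cost cs1))" if m: "p + steps_sum cs2 \<in> S"
      proof -
        have "F1 (p + steps_sum cs2) \<le> ereal (of_int (steps_cost cs1 + 0))"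
        proof (rule follow_steps[where D = C1 and S = S and B = "S - X", OF step1 stop1 _ sub1 m])
          show "p + steps_sum cs2 + steps_sum xs + v \<in> S \<or> p + steps_sum cs2 + steps_sum xs \<in> S - X"
            if "cs1 = xs @ (v, w) # ys" "p + steps_sum cs2 + steps_sum xs \<in> S" for xs v w ys
            using stay[of "cs2 @ xs" v w ys] that ms by (simp add: add.assoc)
          show "F1 (p + steps_sum cs2 + steps_sum cs1) \<le> ereal (of_int 0)"
            using q stop1[of "p + steps_sum cs2 + steps_sum cs1"] by (simp add: sum add.assoc zero_ereal_def)
        qed (use pos C12 in auto)
        then show ?thesis using F21 order_trans by fastforce
      qed
    qed (use pos C12 in auto)
    then show ?thesis by (simp only: cost)
  qed

  have "F2 p \<le> (INF q\<in>S - X. chamfer_dist C p q)"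
    unfolding chamfer_dist_def
  proof (intro INF_greatest)
    fix q \<alpha> assume q: "q \<in> S - X" and "\<alpha> \<in> mask_paths C p q"
    then have \<alpha>: "(\<Sum>c\<in>C. real (\<alpha> c) *\<^sub>R fst c) = q - p" by (simp add: mask_paths_def)
    from assms(10) show "F2 p \<le> ereal (of_int (path_cost C \<alpha>))"
    proof
      assume border: "\<forall>x. border_point S C x \<longrightarrow> x \<in> S - X"
      obtain cs where cs: "set cs \<subseteq> C" "steps_sum cs = q - p" "steps_cost cs = path_cost C \<alpha>"
        using multiplicities_as_steps[OF fin, of "\<lambda>c. c" \<alpha>] \<alpha> by (auto simp: path_cost_def)
      \<comment> \<open>A step out of \<open>S\<close> starts at a border point, which is background
        by hypothesis.\<close>
      have "F2 p \<le> ereal (of_int (steps_cost cs))"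
      proof (rule steps_bound[OF cs(1)])
        fix xs v w ys
        assume "mset (xs @ (v, w) # ys) = mset cs" and x: "p + steps_sum xs \<in> S"
        then have "(v, w) \<in> C" using cs(1) by (metis in_set_conv_decomp mset_eq_setD subsetD)
        then have "v \<in> fst ` C" by force
        then show "p + steps_sum xs + v \<in> S \<or> p + steps_sum xs \<in> S - X"
          using border x unfolding border_point_def by blast
      qed (use q cs in simp)
      then show ?thesis using cs by simp
    next
      assume wp: "wedge_preserving G C S"
      \<comment> \<open>The given path may leave \<open>S\<close>; it is replaced by one with the
        same ends whose steps generate a single wedge.\<close>
      have "q - p \<in> G" using q p assms(1,3) by (auto intro: zmod.subspace_diff)
      then obtain U \<beta> where U: "U \<in> \<W>" and \<beta>: "q - p = (\<Sum>u\<in>U. real (\<beta> u) *\<^sub>R u)"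
        using gen by blast
      have "\<forall>u\<in>U. \<exists>w. (u, w) \<in> C" using U W2 by force
      then obtain wt where wt: "\<And>u. u \<in> U \<Longrightarrow> (u, wt u) \<in> C" by metis
      have wU: "wedge G C U" using W1 U .
      have finU: "finite U" using wU finite_subset fin by (auto simp: wedge_def)
      have UG: "U \<subseteq> G" using wt CG by blast
      obtain cs where cs: "set cs \<subseteq> (\<lambda>u. (u, wt u)) ` U" "steps_sum cs = q - p"
        "steps_cost cs = (\<Sum>u\<in>U. int (\<beta> u) * wt u)"
        using multiplicities_as_steps[OF finU, of "\<lambda>u. (u, wt u)" \<beta>] \<beta> by auto
      have "F2 p \<le> ereal (of_int (steps_cost cs))"
      proof (rule steps_bound)
        fix xs v w ys
        assume m: "mset (xs @ (v, w) # ys) = mset cs" and x: "p + steps_sum xs \<in> S"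
        \<comment> \<open>Every reordering still ends at \<open>q\<close>, so the prefix in question
          is part of a wedge path between two points of \<open>S\<close>.\<close>
        have "sum_mset (image_mset fst (mset (xs @ (v, w) # ys))) = steps_sum cs"
          unfolding m by (metis mset_map sum_mset_sum_list)
        then have "steps_sum (xs @ (v, w) # ys) = steps_sum cs"
          by (metis mset_map sum_mset_sum_list)
        then have "p + steps_sum ((xs @ [(v, w)]) @ ys) \<in> S" using q cs by simp
        moreover have "fst ` set ((xs @ [(v, w)]) @ ys) \<subseteq> U"
          using cs(1) mset_eq_setD[OF m] by force
        ultimately have "p + steps_sum (xs @ [(v, w)]) \<in> S"
          using wedge_preserving_stay[OF wp assms(1) wU UG p] by blast
        then show "p + steps_sum xs + v \<in> S \<or> p + steps_sum xs \<in> S - X" by (simp add: add.assoc)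
      qed (use q cs wt in auto)
      \<comment> \<open>Convexity of the polytope enters here: the replacement costs no more than
        the given path.\<close>
      also have "real_of_int (steps_cost cs) = (\<Sum>u\<in>U. real (\<beta> u) * of_int (wt u))"
        by (simp add: cs)
      also have "\<dots> \<le> real_of_int (path_cost C \<alpha>)"
        by (rule wedge_path_minimal[OF fin pos sym W1 W2 P U wt]) (use \<alpha> \<beta> in auto)
      finally show ?thesis by simp
    qed
  qed
  moreover have "(INF q\<in>S - X. chamfer_dist C p q) \<le> F2 p"
  proof -
    \<comment> \<open>For the lower bound, the distance to the background satisfies the step
      inequality for all of \<open>C\<close> and lies below the initial image, so both scans
      preserve it as a lower bound.\<close>
    define L where "L x = (INF q\<in>S - X. chamfer_dist C x q)" for x
    have L: "L x \<le> ereal (of_int w) + L (x + v)" if "(v, w) \<in> C" for x v w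
    proof -
      have "L x - ereal (of_int w) \<le> L (x + v)"
        unfolding L_def[of "x + v"]
      proof (rule INF_greatest)
        fix q assume q: "q \<in> S - X"
        have "L x \<le> chamfer_dist C x q" unfolding L_def using q by (rule INF_lower)
        also have "\<dots> \<le> ereal (of_int w) + chamfer_dist C (x + v) q"
          using chamfer_dist_step[OF fin that] .
        finally show "L x - ereal (of_int w) \<le> chamfer_dist C (x + v) q"
          by (simp add: ereal_minus_le add.commute)
      qed
      then show ?thesis by (simp add: ereal_minus_le add.commute)
    qed
    have "L x \<le> initial_image X x" if "x \<in> S" for x
      using that chamfer_dist_refl_le[of C x] unfolding L_def
      by (auto simp: initial_image_def intro: INF_lower2[of x])
    then have "L x \<le> F1 x" if "x \<in> S" for x
      unfolding F1_def using L C12 that by (intro scan_lower_bound) auto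
    then have "L p \<le> F2 p"
      unfolding F2_def using L C12 p by (intro scan_lower_bound) auto
    then show ?thesis by (simp add: L_def)
  qed
  ultimately show "chamfer_algorithm S X (scanning_mask1 a C) (scanning_mask2 a C) ps p
                = (INF q\<in>S - X. chamfer_dist C p q)"
    unfolding chamfer_algorithm_def F1_def F2_def C1_def C2_def by (rule antisym)
qed

end
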